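(* If $\mathcal{A}$ is an essential arrangement of finitely many affine hyperplanes in $\mathbb{R}^d$ defined over $\mathbb{Q}$ and $\varepsilon\in(0,\infty)^{\mathcal{A}}$ is a rational point, then $\mathrm{Gal}(\mathbb{Q}^{\mathrm{tr}}/\mathbb{Q})$ acts on the set of critical points of the master function of $\mathcal{A}$ with weights $\varepsilon$, and hence on the set of bounded chambers of $\mathcal{A}$.
   Context: An arrangement $\mathcal{A}$ in $\mathbb{R}^d$ is a finite set of affine hyperplanes, equipped with affine functionals $f_H:\mathbb{R}^d\to\mathbb{R}$ for $H\in\mathcal{A}$ such that $H$ is the zero set of $f_H$. It is defined over $\mathbb{Q}$ if all coefficients of all $f_H$ in the standard basis are rational, and essential if the normal vectors of its hyperplanes span $\mathbb{R}^d$. Chambers of $\mathcal{A}$ are the connected components of $\mathbb{R}^d\setminus\bigcup_{H\in\mathcal{A}}H$. Let $M(\mathcal{A}_{\mathbb{C}})=\{x\in\mathbb{C}^d: f_H(x)\neq0\text{ for all }H\in\mathcal{A}\}$. The master function of $\mathcal{A}$ with weights $\varepsilon$ is the multivalued function $\Phi(x)=\sum_{H\in\mathcal{A}}\varepsilon_H\log f_H(x)$ on $M(\mathcal{A}_{\mathbb{C}})$. A point $x\in M(\mathcal{A}_{\mathbb{C}})$ is a critical point of the master function if $\sum_{H\in\mathcal{A}}\frac{\partial f_H}{\partial x_i}\frac{\varepsilon_H}{f_H(x)}=0$ for all $i=1,\dots,d$. By a theorem of Varchenko, for $\mathcal{A}$ real and essential and $\varepsilon\in(0,\infty)^{\mathcal{A}}$,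 the critical points form a system of distinct representatives for the bounded chambers of $\mathcal{A}$ (there are as many critical points as bounded chambers, and each bounded chamber contains one). An algebraic number in $\mathbb{R}$ is totally real if all of its Galois conjugates over $\mathbb{Q}$ are real; $\mathbb{Q}^{\mathrm{tr}}$ is the field of all totally real numbers, and the (infinite) extension $\mathbb{Q}^{\mathrm{tr}}/\mathbb{Q}$ is Galois. *)

theory Defs
  imports "HOL-Analysis.Analysis" "HOL-Algebra.Group_Action"
begin

section \<open>Affine hyperplane arrangements\<close>

text \<open>
  The affine functional with coefficients \<open>a\<close> and constant term \<open>b\<close>. It is polymorphic in the
  scalars: at type \<^typ>\<open>real\<close> it is $f_H$ itself, at type \<^typ>\<open>complex\<close> it is the extension of
  $f_H$ to $\mathbb{C}^d$.
\<close>

definition affine_functional ::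
    "real ^ 'd::finite \<Rightarrow> real \<Rightarrow> 'k::real_normed_field ^ 'd \<Rightarrow> 'k" where
  "affine_functional a b x = (\<Sum>i\<in>UNIV. of_real (a $ i) * x $ i) + of_real b"

text \<open>
  An arrangement is a finite set \<open>A\<close> of hyperplanes together with the coefficients \<open>a H\<close>, \<open>b H\<close>
  of a functional for each \<open>H \<in> A\<close>. The condition \<open>a H \<noteq> 0\<close> says that the zero set \<open>H\<close> is
  indeed a hyperplane. Values of \<open>a\<close> and \<open>b\<close> outside \<open>A\<close> are irrelevant.
\<close>

definition arrangement ::
    "(real ^ 'd::finite) set set \<Rightarrow> ((real ^ 'd) set \<Rightarrow> real ^ 'd) \<Rightarrow> ((real ^ 'd) set \<Rightarrow> real) \<Rightarrow> bool"
  where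
  "arrangement A a b \<longleftrightarrow>
     finite A \<and> (\<forall>H\<in>A. a H \<noteq> 0 \<and> H = {x. affine_functional (a H) (b H) x = 0})"

definition defined_over_rationals ::
    "(real ^ 'd::finite) set set \<Rightarrow> ((real ^ 'd) set \<Rightarrow> real ^ 'd) \<Rightarrow> ((real ^ 'd) set \<Rightarrow> real) \<Rightarrow> bool"
  where
  "defined_over_rationals A a b \<longleftrightarrow> (\<forall>H\<in>A. (\<forall>i. a H $ i \<in> \<rat>) \<and> b H \<in> \<rat>)"

definition essential ::
    "(real ^ 'd::finite) set set \<Rightarrow> ((real ^ 'd) set \<Rightarrow> real ^ 'd) \<Rightarrow> bool" where
  "essential A a \<longleftrightarrow> span (a ` A) = UNIV"

definition chambers :: "(real ^ 'd::finite) set set \<Rightarrow> (real ^ 'd) set set" where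
  "chambers A = components (UNIV - \<Union>A)"

definition bounded_chambers :: "(real ^ 'd::finite) set set \<Rightarrow> (real ^ 'd) set set" where
  "bounded_chambers A = {C \<in> chambers A. bounded C}"


section \<open>Critical points of the master function\<close>

definition complex_complement ::
    "(real ^ 'd::finite) set set \<Rightarrow> ((real ^ 'd) set \<Rightarrow> real ^ 'd) \<Rightarrow> ((real ^ 'd) set \<Rightarrow> real) \<Rightarrow>
     (complex ^ 'd) set" where
  "complex_complement A a b = {x. \<forall>H\<in>A. affine_functional (a H) (b H) x \<noteq> 0}"

definition complex_partial ::
    "(complex ^ 'd::finite \<Rightarrow> complex) \<Rightarrow> 'd \<Rightarrow> complex ^ 'd \<Rightarrow> complex" where
  "complex_partial f i x = deriv (\<lambda>t. f (\<chi> j. if j = i then t else x $ j)) (x $ i)"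

lemma complex_partial_affine_functional:
  "complex_partial (affine_functional a b) i x = of_real (a $ i)"
proof -
  let ?c = "(\<Sum>j\<in>UNIV - {i}. of_real (a $ j) * x $ j) + of_real b :: complex"
  have "affine_functional a b (\<chi> j. if j = i then t else x $ j) = of_real (a $ i) * t + ?c" for t
    by (simp add: affine_functional_def sum.remove[of UNIV i])
  moreover have "((\<lambda>t. of_real (a $ i) * t + ?c) has_field_derivative of_real (a $ i)) (at (x $ i))"
    by (auto intro!: derivative_eq_intros)
  ultimately show ?thesis
    by (simp add: complex_partial_def DERIV_imp_deriv)
qed

definition critical_points ::
    "(real ^ 'd::finite) set set \<Rightarrow> ((real ^ 'd) set \<Rightarrow> real ^ 'd) \<Rightarrow> ((real ^ 'd) set \<Rightarrow> real) \<Rightarrow>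
     ((real ^ 'd) set \<Rightarrow> real) \<Rightarrow> (complex ^ 'd) set" where
  "critical_points A a b \<epsilon> =
     {x \<in> complex_complement A a b.
        \<forall>i. (\<Sum>H\<in>A. complex_partial (affine_functional (a H) (b H)) i x *
                     (of_real (\<epsilon> H) / affine_functional (a H) (b H) x)) = 0}"

definition complexify :: "real ^ 'd::finite \<Rightarrow> complex ^ 'd" where
  "complexify x = (\<chi> i. of_real (x $ i))"

text \<open>
  Only meaningful for points of $\mathbb{C}^d$ that are real and lie on no hyperplane;
  for those the chamber is unique.
\<close>

definition chamber_of :: "(real ^ 'd::finite) set set \<Rightarrow> complex ^ 'd \<Rightarrow> (real ^ 'd) set" where
  "chamber_of A z = (THE C. C \<in> chambers A \<and> z \<in> complexify ` C)"


section \<open>Totally real numbers and their Galois group\<close>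

text \<open>
  \<open>p\<close> below is, up to a unit, the minimal polynomial of \<open>x\<close> over the rationals;
  a transcendental number has no conjugates in this sense.
\<close>

definition galois_conjugate :: "complex \<Rightarrow> complex \<Rightarrow> bool" where
  "galois_conjugate x z \<longleftrightarrow>
     (\<exists>p :: rat poly. irreducible p \<and> poly (map_poly of_rat p) x = 0 \<and>
                      poly (map_poly of_rat p) z = 0)"

text \<open>The field $\mathbb{Q}^{\mathrm{tr}}$, regarded as a subset of the complex numbers.\<close>

definition totally_real :: "complex set" where
  "totally_real = {x \<in> \<real>. algebraic x \<and> (\<forall>z. galois_conjugate x z \<longrightarrow> z \<in> \<real>)}"

text \<open>
  Field automorphisms of \<open>L\<close> that fix \<open>K\<close> pointwise. As for \<^const>\<open>Bij\<close>, they are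
  represented by extensional functions, and the group operation is composition.
\<close>

definition galois_group :: "complex set \<Rightarrow> complex set \<Rightarrow> (complex \<Rightarrow> complex) monoid" where
  "galois_group L K = (BijGroup L)
     \<lparr>carrier := {\<sigma> \<in> Bij L. (\<forall>x\<in>L. \<forall>y\<in>L. \<sigma> (x + y) = \<sigma> x + \<sigma> y \<and> \<sigma> (x * y) = \<sigma> x * \<sigma> y) \<and>
                            (\<forall>x\<in>K. \<sigma> x = x)}\<rparr>"

definition coordinatewise :: "(complex \<Rightarrow> complex) \<Rightarrow> complex ^ 'd::finite \<Rightarrow> complex ^ 'd" where
  "coordinatewise \<sigma> x = (\<chi> i. \<sigma> (x $ i))"

end

theory Submission
  imports
    Defs
    "HOL-Computational_Algebra.Fundamental_Theorem_Algebra"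
    "HOL-Computational_Algebra.Polynomial_Factorial"
    "HOL-Computational_Algebra.Field_as_Ring"
begin

text \<open>
  An embedding into \<open>\<complex>\<close> of a countable subring of \<open>\<complex>\<close> containing \<open>\<rat>\<close> extends to any further
  complex number, and a number transcendental over the subring can be sent to a non-real one. Hence
  \<open>x\<close> is totally real iff every such embedding defined at \<open>x\<close> takes a real value there; this
  makes the totally real numbers a ring. Embeddings fix the rational coefficients of the critical
  equations, so they map critical points to critical points; as all critical points are
  real, their coordinates are totally real, and the Galois group acts.

  That the critical points represent the bounded chambers is a concavity argument: a critical point
  maximises $\prod_H |f_H|^{\varepsilon_H}$ on its chamber, and on that chamber
  $\sum_H \varepsilon_H f_H(y)/f_H(x) = \sum_H \varepsilon_H$ bounds every $f_H$.
\<close>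

section \<open>Embeddings of rings of complex numbers\<close>

text \<open>\<open>D\<close> is a subring and not necessarily a subfield, so that adjoining
  \<open>x\<close> only takes values of polynomials at \<open>x\<close>. Injectivity, automatic on a
  field, is therefore an assumption.\<close>

locale rational_embedding =
  fixes D :: "complex set" and \<phi> :: "complex \<Rightarrow> complex"
  assumes Rats_subset: "\<rat> \<subseteq> D"
    and add_closed: "x \<in> D \<Longrightarrow> y \<in> D \<Longrightarrow> x + y \<in> D"
    and mult_closed: "x \<in> D \<Longrightarrow> y \<in> D \<Longrightarrow> x * y \<in> D"
    and hom_add: "x \<in> D \<Longrightarrow> y \<in> D \<Longrightarrow> \<phi> (x + y) = \<phi> x + \<phi> y"
    and hom_mult: "x \<in> D \<Longrightarrow> y \<in> D \<Longrightarrow> \<phi> (x * y) = \<phi> x * \<phi> y"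
    and inj: "inj_on \<phi> D"
    and fix_Rats: "x \<in> \<rat> \<Longrightarrow> \<phi> x = x"
begin

lemma zero_closed: "0 \<in> D" and one_closed: "1 \<in> D"
  using Rats_subset by auto

lemma hom_zero [simp]: "\<phi> 0 = 0" and hom_one [simp]: "\<phi> 1 = 1"
  using fix_Rats by auto

lemma hom_eq_0_iff: "x \<in> D \<Longrightarrow> \<phi> x = 0 \<longleftrightarrow> x = 0"
  using inj zero_closed hom_zero by (metis inj_onD)

lemma uminus_closed: "x \<in> D \<Longrightarrow> - x \<in> D"
  using mult_closed[of "-1" x] Rats_subset by (auto simp: subset_iff)

lemma diff_closed: "x \<in> D \<Longrightarrow> y \<in> D \<Longrightarrow> x - y \<in> D"
  using add_closed[of x "- y"] uminus_closed by simp

lemma sum_closed: "(\<And>i. i \<in> I \<Longrightarrow> f i \<in> D) \<Longrightarrow> sum f I \<in> D"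
  by (induction I rule: infinite_finite_induct) (auto simp: zero_closed add_closed)

lemma prod_closed: "(\<And>i. i \<in> I \<Longrightarrow> f i \<in> D) \<Longrightarrow> prod f I \<in> D"
  by (induction I rule: infinite_finite_induct) (auto simp: one_closed mult_closed)

lemma power_closed: "x \<in> D \<Longrightarrow> x ^ n \<in> D"
  by (induction n) (auto simp: one_closed mult_closed)

lemma hom_sum: "(\<And>i. i \<in> I \<Longrightarrow> f i \<in> D) \<Longrightarrow> \<phi> (sum f I) = (\<Sum>i\<in>I. \<phi> (f i))"
  by (induction I rule: infinite_finite_induct) (auto simp: hom_add sum_closed)

lemma hom_prod: "(\<And>i. i \<in> I \<Longrightarrow> f i \<in> D) \<Longrightarrow> \<phi> (prod f I) = (\<Prod>i\<in>I. \<phi> (f i))"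
  by (induction I rule: infinite_finite_induct) (auto simp: hom_mult prod_closed)

lemma hom_power: "x \<in> D \<Longrightarrow> \<phi> (x ^ n) = \<phi> x ^ n"
  by (induction n) (auto simp: hom_mult power_closed)

section \<open>Polynomials over \<open>D\<close> and their images under
  \<open>\<phi>\<close>\<close>

definition polys :: "complex poly set" where
  "polys = {p. \<forall>i. coeff p i \<in> D}"

lemma coeff_closed: "p \<in> polys \<Longrightarrow> coeff p i \<in> D"
  by (simp add: polys_def)

lemma polys_0: "0 \<in> polys"
  by (simp add: polys_def zero_closed)

lemma polys_const: "c \<in> D \<Longrightarrow> [:c:] \<in> polys"
  by (auto simp: polys_def coeff_pCons zero_closed split: nat.split)

lemma polys_X: "[:0, 1:] \<in> polys"
  by (auto simp: polys_def coeff_pCons zero_closed one_closed split: nat.split)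

lemma polys_monom: "c \<in> D \<Longrightarrow> Polynomial.monom c n \<in> polys"
  by (auto simp: polys_def zero_closed)

lemma polys_add: "p \<in> polys \<Longrightarrow> q \<in> polys \<Longrightarrow> p + q \<in> polys"
  by (auto simp: polys_def add_closed)

lemma polys_diff: "p \<in> polys \<Longrightarrow> q \<in> polys \<Longrightarrow> p - q \<in> polys"
  by (auto simp: polys_def diff_closed)

lemma polys_smult: "c \<in> D \<Longrightarrow> p \<in> polys \<Longrightarrow> Polynomial.smult c p \<in> polys"
  by (auto simp: polys_def mult_closed)

lemma polys_mult: "p \<in> polys \<Longrightarrow> q \<in> polys \<Longrightarrow> p * q \<in> polys"
  by (auto simp: polys_def coeff_mult intro!: sum_closed mult_closed)

abbreviation hom_poly :: "complex poly \<Rightarrow> complex poly" where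
  "hom_poly \<equiv> map_poly \<phi>"

lemma hom_poly_add: "p \<in> polys \<Longrightarrow> q \<in> polys \<Longrightarrow> hom_poly (p + q) = hom_poly p + hom_poly q"
  by (rule poly_eqI) (simp add: coeff_map_poly hom_add coeff_closed)

lemma hom_poly_smult:
  "c \<in> D \<Longrightarrow> p \<in> polys \<Longrightarrow> hom_poly (Polynomial.smult c p) = Polynomial.smult (\<phi> c) (hom_poly p)"
  by (rule poly_eqI) (simp add: coeff_map_poly hom_mult coeff_closed)

lemma hom_poly_mult: "p \<in> polys \<Longrightarrow> q \<in> polys \<Longrightarrow> hom_poly (p * q) = hom_poly p * hom_poly q"
  by (rule poly_eqI) (simp add: coeff_map_poly coeff_mult hom_sum hom_mult mult_closed coeff_closed)

lemma degree_hom_poly: "p \<in> polys \<Longrightarrow> degree (hom_poly p) = degree p"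
  by (intro antisym map_poly_degree_leq)
    (cases "p = 0", auto intro!: le_degree simp: coeff_map_poly hom_eq_0_iff coeff_closed)

lemma hom_poly_eq_0_iff: "p \<in> polys \<Longrightarrow> hom_poly p = 0 \<longleftrightarrow> p = 0"
  by (auto simp: poly_eq_iff coeff_map_poly hom_eq_0_iff coeff_closed)

lemma hom_poly_eval:
  assumes "p \<in> polys" "x \<in> D"
  shows "\<phi> (poly p x) = poly (hom_poly p) (\<phi> x)"
  using assms
  by (simp add: poly_altdef degree_hom_poly coeff_map_poly hom_sum hom_mult hom_power
      mult_closed power_closed coeff_closed)

text \<open>\<open>D\<close> is not a field, so division with remainder needs a power of the leading coefficient.\<close>

lemma pseudo_division:
  assumes "p \<in> polys" "q \<in> polys" "q \<noteq> 0"
  obtains k s r where "s \<in> polys" "r \<in> polys"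
    "Polynomial.smult (lead_coeff q ^ k) p = s * q + r" "r = 0 \<or> degree r < degree q"
proof -
  let ?l = "lead_coeff q"
  have "\<exists>k s r. s \<in> polys \<and> r \<in> polys \<and> Polynomial.smult (?l ^ k) p = s * q + r \<and>
          (r = 0 \<or> degree r < degree q)"
    using assms(1)
  proof (induction "degree p" arbitrary: p rule: less_induct)
    case less
    show ?case
    proof (cases "p = 0 \<or> degree p < degree q")
      case True
      then show ?thesis
        using less.prems polys_0 by (intro exI[of _ 0] exI[of _ p]) auto
    next
      case False
      \<comment> \<open>One step of long division: \<open>m * q\<close> and
        \<open>Polynomial.smult ?l p\<close> have the same top coefficient, so it cancels in
        \<open>p'\<close> without dividing by \<open>?l\<close>.\<close>
      define m where "m = Polynomial.monom (lead_coeff p) (degree p - degree q)"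
      define p' where "p' = Polynomial.smult ?l p - m * q"
      have m: "m \<in> polys" unfolding m_def using less.prems by (intro polys_monom coeff_closed)
      have p': "p' \<in> polys" unfolding p'_def
        using less.prems assms m by (intro polys_diff polys_smult polys_mult coeff_closed)
      have "m \<noteq> 0" using False by (simp add: m_def)
      hence "degree (m * q) = degree p"
        using False assms(3) by (simp add: degree_mult_eq m_def degree_monom_eq)
      hence le: "degree p' \<le> degree p" unfolding p'_def
        by (intro degree_diff_le) (auto simp: degree_smult_le)
      have "coeff (m * q) (degree p) = lead_coeff m * ?l"
        using \<open>degree (m * q) = degree p\<close> by (metis lead_coeff_mult)
      hence c: "coeff p' (degree p) = 0"
        using False by (simp add: p'_def m_def degree_monom_eq)
      have "\<exists>k s r. s \<in> polys \<and> r \<in> polys \<and> Polynomial.smult (?l ^ k) p' = s * q + r \<and>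
          (r = 0 \<or> degree r < degree q)"
      \<comment> \<open>For \<open>degree p = 0\<close> the degree cannot drop, but then the
        cancelled coefficient is the only one and \<open>p' = 0\<close>.\<close>
      proof (cases "p' = 0")
        case True
        then show ?thesis using polys_0 by (intro exI[of _ 0]) auto
      next
        case False
        hence "degree p' < degree p" using le c by (metis le_neq_implies_less leading_coeff_0_iff)
        then show ?thesis using less.hyps p' by blast
      qed
      then obtain k s r where *: "s \<in> polys" "r \<in> polys"
        "Polynomial.smult (?l ^ k) p' = s * q + r" "r = 0 \<or> degree r < degree q" by blast
      have "Polynomial.smult (?l ^ Suc k) p = (s + Polynomial.smult (?l ^ k) m) * q + r"
        using *(3) by (simp add: p'_def smult_diff_right algebra_simps)
      moreover have "s + Polynomial.smult (?l ^ k) m \<in> polys"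
        using * m assms by (intro polys_add polys_smult power_closed coeff_closed)
      ultimately show ?thesis using * by blast
    qed
  qed
  thus ?thesis using that by blast
qed

text \<open>At a zero of \<open>q\<close> the term \<open>s * q\<close> drops out, and the factor
  \<open>lead_coeff q ^ k\<close> can be cancelled: it is nonzero, and so is its image because
  \<open>\<phi>\<close> is injective on \<open>D\<close>.\<close>

lemma poly_pseudo_remainder:
  assumes "p \<in> polys" "q \<in> polys" "q \<noteq> 0" "s \<in> polys" "r \<in> polys"
    and "Polynomial.smult (lead_coeff q ^ k) p = s * q + r"
  shows "poly q x = 0 \<Longrightarrow> poly r x = 0 \<longleftrightarrow> poly p x = 0"
    and "poly (hom_poly q) y = 0 \<Longrightarrow> poly (hom_poly r) y = 0 \<longleftrightarrow> poly (hom_poly p) y = 0"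
proof -
  assume "poly q x = 0"
  moreover have "lead_coeff q ^ k * poly p x = poly s x * poly q x + poly r x"
    using arg_cong[OF assms(6), of "\<lambda>p. poly p x"] by simp
  ultimately show "poly r x = 0 \<longleftrightarrow> poly p x = 0"
    using assms(3) by (auto simp: zero_eq_add_iff_both_eq_0)
next
  assume y: "poly (hom_poly q) y = 0"
  have l: "lead_coeff q ^ k \<in> D" using assms by (intro power_closed coeff_closed)
  have "Polynomial.smult (\<phi> (lead_coeff q ^ k)) (hom_poly p) = hom_poly s * hom_poly q + hom_poly r"
    using arg_cong[OF assms(6), of hom_poly]
    unfolding hom_poly_smult[OF l assms(1)] hom_poly_add[OF polys_mult[OF assms(4,2)] assms(5)]
      hom_poly_mult[OF assms(4,2)] .
  from arg_cong[OF this, of "\<lambda>p. poly p y"] y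
  have "\<phi> (lead_coeff q ^ k) * poly (hom_poly p) y = poly (hom_poly r) y" by simp
  moreover have "\<phi> (lead_coeff q ^ k) \<noteq> 0" using l assms(3) by (simp add: hom_eq_0_iff)
  ultimately show "poly (hom_poly r) y = 0 \<longleftrightarrow> poly (hom_poly p) y = 0" by auto
qed

text \<open>The image of \<open>p\<close> turns out to have least degree at \<open>y\<close>, just
  as \<open>p\<close> has at \<open>x\<close>. Hence a pseudo-remainder modulo \<open>p\<close>
  vanishes at \<open>x\<close>, or its image at \<open>y\<close>, only if it is 0.\<close>

lemma same_zeros_algebraic:
  assumes p: "p \<in> polys" "p \<noteq> 0" "poly p x = 0" "poly (hom_poly p) y = 0"
    and min: "\<And>q. q \<in> polys \<Longrightarrow> q \<noteq> 0 \<Longrightarrow> poly q x = 0 \<Longrightarrow> degree p \<le> degree q"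
    and q: "q \<in> polys"
  shows "poly q x = 0 \<longleftrightarrow> poly (hom_poly q) y = 0"
proof -
  \<comment> \<open>If some smaller degree occurs at \<open>y\<close>, a \<open>t\<close> of least
    degree there divides a constant multiple of \<open>p\<close>. Both \<open>t\<close> and the
    cofactor \<open>s\<close> have degree below that of \<open>p\<close>, and one of them vanishes
    at \<open>x\<close>, against \<open>min\<close>.\<close>
  have min': "degree p \<le> degree r" if r: "r \<in> polys" "r \<noteq> 0" "poly (hom_poly r) y = 0" for r
  proof (rule ccontr)
    assume "\<not> degree p \<le> degree r"
    define P where "P = (\<lambda>t. t \<in> polys \<and> t \<noteq> 0 \<and> poly (hom_poly t) y = 0)"
    define t where "t = arg_min degree P"
    have "P r" using r by (simp add: P_def)
    hence t: "P t" and "degree t \<le> degree r" and tmin: "\<And>u. P u \<Longrightarrow> degree t \<le> degree u"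
      unfolding t_def using arg_min_nat_lemma[of P r degree] by blast+
    with \<open>\<not> degree p \<le> degree r\<close> have lt: "degree t < degree p" by simp
    obtain k s u where ku: "s \<in> polys" "u \<in> polys" "Polynomial.smult (lead_coeff t ^ k) p = s * t + u"
      "u = 0 \<or> degree u < degree t"
      using pseudo_division[of p t] p t unfolding P_def by metis
    have "poly (hom_poly u) y = 0"
      using poly_pseudo_remainder(2)[OF _ _ _ ku(1,2,3), of y] p t by (auto simp: P_def)
    hence "u = 0" using ku tmin[of u] by (fastforce simp: P_def)
    hence eq: "Polynomial.smult (lead_coeff t ^ k) p = s * t" using ku by simp
    have "t \<noteq> 0" using t by (simp add: P_def)
    hence "s \<noteq> 0" using eq p by auto
    hence deg: "degree p = degree s + degree t"
      using arg_cong[OF eq, of degree] \<open>t \<noteq> 0\<close> by (simp add: degree_mult_eq)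
    \<comment> \<open>This makes the degree of \<open>s\<close> strictly smaller than that of
      \<open>p\<close>. A nonzero constant has a nonzero image, which has no zero at
      \<open>y\<close>.\<close>
    have "degree t \<noteq> 0"
    proof
      assume "degree t = 0"
      then obtain c where c: "t = [:c:]" by (rule degree_eq_zeroE)
      hence "c \<in> D" using t coeff_closed[of t 0] by (auto simp: P_def)
      thus False using t c by (auto simp: P_def map_poly_pCons hom_eq_0_iff)
    qed
    moreover have "poly s x = 0 \<or> poly t x = 0"
      using arg_cong[OF eq, of "\<lambda>p. poly p x"] p by simp
    ultimately show False
      using min[of s] min[of t] ku t \<open>s \<noteq> 0\<close> deg lt by (auto simp: P_def)
  qed
  obtain k s r where *: "s \<in> polys" "r \<in> polys" "Polynomial.smult (lead_coeff p ^ k) q = s * p + r"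
      "r = 0 \<or> degree r < degree p"
    using pseudo_division[of q p] p q by metis
  have "poly r x = 0 \<longleftrightarrow> r = 0" using min[of r] * by fastforce
  moreover have "poly (hom_poly r) y = 0 \<longleftrightarrow> r = 0" using min'[of r] * by fastforce
  ultimately show ?thesis
    using poly_pseudo_remainder[OF q p(1,2) *(1,2,3)] p by blast
qed

section \<open>Extending an embedding to further complex numbers\<close>

lemma countable_polys:
  assumes "countable D"
  shows "countable polys"
proof -
  have "polys \<subseteq> Poly ` lists D"
  proof
    fix p assume "p \<in> polys"
    hence "coeffs p \<in> lists D" by (auto simp: coeffs_def coeff_closed)
    thus "p \<in> Poly ` lists D" by (metis Poly_coeffs imageI)
  qed
  thus ?thesis using assms by (meson countable_image countable_lists countable_subset)
qed

text \<open>If \<open>x\<close> is algebraic over \<open>D\<close>, \<open>y\<close> is any zero of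
  the image of a polynomial of least degree. Otherwise \<open>y\<close> only has to avoid the
  countably many zeros of images of nonzero polynomials, which leaves room for a non-real
  choice.\<close>

lemma same_zeros_exists:
  assumes D: "countable D"
  obtains y where "\<And>q. q \<in> polys \<Longrightarrow> poly q x = 0 \<longleftrightarrow> poly (hom_poly q) y = 0"
    and "(\<And>q. q \<in> polys \<Longrightarrow> poly q x = 0 \<Longrightarrow> q = 0) \<Longrightarrow> y \<notin> \<real>"
proof (cases "\<exists>q\<in>polys. q \<noteq> 0 \<and> poly q x = 0")
  case True
  define P where "P = (\<lambda>t. t \<in> polys \<and> t \<noteq> 0 \<and> poly t x = 0)"
  define p where "p = arg_min degree P"
  obtain q where "P q" using True by (auto simp: P_def)
  hence p: "P p" and min: "\<And>u. P u \<Longrightarrow> degree p \<le> degree u"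
    unfolding p_def using arg_min_nat_lemma[of P q degree] by blast+
  have "degree p \<noteq> 0" using p by (metis P_def degree_eq_zeroE mult_zero_right add_0_right pCons_0_0 poly_0 poly_pCons)
  hence "\<not> constant (poly (hom_poly p))"
    using p by (simp add: constant_degree P_def degree_hom_poly)
  then obtain y where "poly (hom_poly p) y = 0" using fundamental_theorem_of_algebra by blast
  \<comment> \<open>The second conclusion is vacuous in this case, since \<open>p\<close> refutes
    its premise.\<close>
  thus ?thesis
    using same_zeros_algebraic[of p x y] p min True that[of y] unfolding P_def by blast
next
  case False
  define Z where "Z = (\<Union>q\<in>polys - {0}. {y. poly (hom_poly q) y = 0})"
  have "countable Z" unfolding Z_def
    using countable_polys[OF D]
    by (intro countable_UN) (auto simp: hom_poly_eq_0_iff intro!: countable_finite poly_roots_finite)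
  \<comment> \<open>Every real number has distance at least 1 from \<open>\<i>\<close>, so this open
    ball contains none.\<close>
  moreover have "uncountable (ball \<i> 1)" by (rule uncountable_ball) simp
  ultimately obtain y where y: "y \<in> ball \<i> 1" "y \<notin> Z"
    using countable_subset by (metis subsetI)
  have "y \<notin> \<real>"
  proof
    assume "y \<in> \<real>"
    hence "\<bar>Im (\<i> - y)\<bar> = 1" by (simp add: complex_is_Real_iff)
    thus False using y abs_Im_le_cmod[of "\<i> - y"] by (simp add: dist_norm)
  qed
  moreover have "poly q x = 0 \<longleftrightarrow> poly (hom_poly q) y = 0" if "q \<in> polys" for q
    using that y False by (cases "q = 0") (auto simp: Z_def)
  ultimately show ?thesis using that by blast
qed

text \<open>\<open>D'\<close> is the ring \<open>D[x]\<close>, and \<open>\<psi>\<close> sends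
  \<open>poly p x\<close> to \<open>poly (hom_poly p) y\<close>. One direction of the equivalence,
  applied to differences of polynomials, makes this well defined, the other makes it
  injective.\<close>

lemma adjoin:
  assumes y: "\<And>q. q \<in> polys \<Longrightarrow> poly q x = 0 \<longleftrightarrow> poly (hom_poly q) y = 0"
  obtains D' \<psi> where "rational_embedding D' \<psi>" "D \<subseteq> D'" "x \<in> D'" "\<psi> x = y"
    "\<And>u. u \<in> D \<Longrightarrow> \<psi> u = \<phi> u" "countable D \<Longrightarrow> countable D'"
proof -
  define D' where "D' = (\<lambda>p. poly p x) ` polys"
  define \<psi> where "\<psi> u = poly (hom_poly (SOME p. p \<in> polys \<and> poly p x = u)) y" for u
  have \<psi>: "\<psi> (poly p x) = poly (hom_poly p) y" if p: "p \<in> polys" for p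
  proof -
    define q where "q = (SOME q. q \<in> polys \<and> poly q x = poly p x)"
    have q: "q \<in> polys" "poly q x = poly p x"
      using someI[of "\<lambda>q. q \<in> polys \<and> poly q x = poly p x" p] p unfolding q_def by auto
    have "poly (hom_poly (q - p)) y = 0"
      using y[of "q - p"] p q by (simp add: polys_diff)
    moreover have "hom_poly q = hom_poly (q - p) + hom_poly p"
      using hom_poly_add[of "q - p" p] p q by (simp add: polys_diff)
    ultimately show ?thesis by (simp add: \<psi>_def q_def)
  qed
  have const: "u \<in> D'" "\<psi> u = \<phi> u" if "u \<in> D" for u
  proof -
    have "u = poly [:u:] x" by simp
    thus "u \<in> D'" unfolding D'_def using polys_const[OF that] by blast
    show "\<psi> u = \<phi> u" using \<psi>[OF polys_const[OF that]] by (simp add: map_poly_pCons)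
  qed
  have "rational_embedding D' \<psi>"
  proof
    show "\<rat> \<subseteq> D'" using const Rats_subset by blast
    show "\<psi> u = u" if "u \<in> \<rat>" for u using that const Rats_subset fix_Rats by auto
    fix u v assume "u \<in> D'" "v \<in> D'"
    then obtain p q where pq: "p \<in> polys" "q \<in> polys" "u = poly p x" "v = poly q x"
      by (auto simp: D'_def)
    have "u + v = poly (p + q) x" "u * v = poly (p * q) x" using pq by auto
    thus "u + v \<in> D'" "u * v \<in> D'" "\<psi> (u + v) = \<psi> u + \<psi> v" "\<psi> (u * v) = \<psi> u * \<psi> v"
      using pq polys_add polys_mult
      by (metis D'_def \<psi> hom_poly_add hom_poly_mult image_eqI poly_add poly_mult)+
  next
    show "inj_on \<psi> D'"
    proof (rule inj_onI)
      fix u v assume "u \<in> D'" "v \<in> D'" and eq: "\<psi> u = \<psi> v"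
      then obtain p q where pq: "p \<in> polys" "q \<in> polys" "u = poly p x" "v = poly q x"
        by (auto simp: D'_def)
      have "hom_poly p = hom_poly (p - q) + hom_poly q"
        using hom_poly_add[of "p - q" q] pq by (simp add: polys_diff)
      hence "poly (hom_poly (p - q)) y = 0" using eq pq by (simp add: \<psi>)
      thus "u = v" using y[of "p - q"] pq by (simp add: polys_diff)
    qed
  qed
  moreover have "poly [:0, 1:] x \<in> D'" unfolding D'_def using polys_X by blast
  hence "x \<in> D'" by simp
  moreover have "\<psi> x = y" using \<psi>[OF polys_X] by (simp add: map_poly_pCons)
  moreover have "countable D \<Longrightarrow> countable D'" unfolding D'_def by (intro countable_image countable_polys)
  ultimately show ?thesis using that const by blast
qed

text \<open>The elements of \<open>X\<close> are adjoined one at a time. Countability is carried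
  along because \<open>same_zeros_exists\<close> needs it at every step.\<close>

lemma extend:
  assumes "countable D" "finite X"
  obtains D' \<psi> where "rational_embedding D' \<psi>" "D \<subseteq> D'" "X \<subseteq> D'"
    "\<forall>u\<in>D. \<psi> u = \<phi> u" "countable D'"
proof -
  have "\<exists>D' \<psi>. rational_embedding D' \<psi> \<and> D \<subseteq> D' \<and> X \<subseteq> D' \<and> (\<forall>u\<in>D. \<psi> u = \<phi> u) \<and> countable D'"
    using assms(2)
  proof (induction X)
    case empty
    show ?case using assms rational_embedding_axioms by blast
  next
    case (insert x X)
    then obtain E \<theta> where E: "rational_embedding E \<theta>" "D \<subseteq> E" "X \<subseteq> E" "\<forall>u\<in>D. \<theta> u = \<phi> u" "countable E"
      by blast
    interpret E: rational_embedding E \<theta> by fact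
    obtain y where "\<And>q. q \<in> E.polys \<Longrightarrow> poly q x = 0 \<longleftrightarrow> poly (E.hom_poly q) y = 0"
      using E.same_zeros_exists[of x] E(5) by blast
    then obtain D' \<psi> where "rational_embedding D' \<psi>" "E \<subseteq> D'" "x \<in> D'" "\<psi> x = y"
      "\<And>u. u \<in> E \<Longrightarrow> \<psi> u = \<theta> u" "countable E \<Longrightarrow> countable D'"
      using E.adjoin by blast
    thus ?case using E by (intro exI[of _ D'] exI[of _ \<psi>]) auto
  qed
  thus ?thesis using that by blast
qed

end

interpretation Rats: rational_embedding \<rat> id
  by standard auto


section \<open>Totally real numbers\<close>

lemma map_poly_of_rat_add:
  "map_poly of_rat (p + q) = (map_poly of_rat p + map_poly of_rat q :: complex poly)"
  by (rule poly_eqI) (simp add: coeff_map_poly of_rat_add)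

lemma map_poly_of_rat_mult:
  "map_poly of_rat (p * q) = (map_poly of_rat p * map_poly of_rat q :: complex poly)"
  by (rule poly_eqI) (simp add: coeff_map_poly coeff_mult of_rat_mult of_rat_sum)

lemma Rats_poly_of_rat_poly:
  assumes "\<And>i. coeff p i \<in> \<rat>"
  obtains q where "p = (map_poly of_rat q :: complex poly)"
proof
  let ?g = "inv_into UNIV (of_rat :: rat \<Rightarrow> complex)"
  have g: "of_rat (?g u) = u" if "u \<in> \<rat>" for u :: complex
    using that by (simp add: Rats_def f_inv_into_f)
  \<comment> \<open>\<open>coeff_map_poly\<close> requires the mapped function to preserve
    0.\<close>
  have "?g 0 = 0" using g[of 0] by (simp only: Rats_0 of_rat_eq_0_iff)
  thus "p = map_poly of_rat (map_poly ?g p)"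
    using assms by (intro poly_eqI) (simp add: coeff_map_poly g)
qed

text \<open>\<open>p\<close> must divide \<open>q\<close>: otherwise a Bezout relation
  \<open>s * p + t * q = 1\<close>, evaluated at \<open>x\<close>, reads 0 = 1.\<close>

lemma irreducible_same_zeros:
  fixes p q :: "rat poly" and x z :: complex
  assumes "irreducible p" "poly (map_poly of_rat p) x = 0" "poly (map_poly of_rat p) z = 0"
    and "poly (map_poly of_rat q) x = 0"
  shows "poly (map_poly of_rat q) z = 0"
proof (cases "p dvd q")
  case True
  then obtain r where "q = p * r" by (rule dvdE)
  thus ?thesis using assms(3) by (simp add: map_poly_of_rat_mult)
next
  case False
  have "prime_elem p" using assms(1) by (rule irreducible_imp_prime_elem)
  hence "coprime p q" using False by (simp add: prime_elem_imp_coprime)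
  then obtain s t where "s * p + t * q = 1"
    using bezout_coefficients_fst_snd[of p q] by auto
  hence "map_poly of_rat (s * p + t * q) = (1 :: complex poly)" by simp
  from arg_cong[OF this, of "\<lambda>p. poly p x"] show ?thesis
    using assms by (simp add: map_poly_of_rat_mult map_poly_of_rat_add)
qed

text \<open>A nonzero polynomial of least degree works: in a factorisation one factor vanishes at
  \<open>x\<close> and so has full degree, which makes the other a unit.\<close>

lemma algebraic_irreducible_poly:
  fixes x :: complex
  assumes "algebraic x"
  obtains p :: "rat poly" where "irreducible p" "poly (map_poly of_rat p) x = 0"
proof -
  define P where "P = (\<lambda>p :: rat poly. p \<noteq> 0 \<and> poly (map_poly of_rat p) x = 0)"
  obtain p0 where "\<And>i. coeff p0 i \<in> \<rat>" "p0 \<noteq> 0" "poly p0 x = 0"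
    using assms by (auto simp: algebraic_altdef)
  then obtain q where "P q" unfolding P_def using Rats_poly_of_rat_poly[of p0] by (metis map_poly_0)
  define p where "p = arg_min degree P"
  have p: "P p" and min: "\<And>u. P u \<Longrightarrow> degree p \<le> degree u"
    unfolding p_def using arg_min_nat_lemma[of P q degree] \<open>P q\<close> by blast+
  have "irreducible p"
  proof (rule irreducibleI)
    show "p \<noteq> 0" using p by (simp add: P_def)
    show "\<not> p dvd 1"
      using p by (auto simp: P_def is_unit_poly_iff map_poly_pCons)
    fix a b assume ab: "p = a * b"
    hence nz: "a \<noteq> 0" "b \<noteq> 0" using p by (auto simp: P_def)
    have "P a \<or> P b" using ab nz p by (auto simp: P_def map_poly_of_rat_mult)
    hence "degree b = 0 \<or> degree a = 0"
      using min[of a] min[of b] ab nz by (auto simp: degree_mult_eq)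
    thus "a dvd 1 \<or> b dvd 1" using nz by (auto simp: is_unit_iff_degree)
  qed
  thus ?thesis using that p by (simp add: P_def)
qed

text \<open>\<open>\<phi>\<close> fixes the rational coefficients of the minimal polynomial and
  therefore permits only its zeros as images of \<open>x\<close>.\<close>

lemma (in rational_embedding) galois_conjugate_hom:
  assumes "algebraic x" "x \<in> D"
  shows "galois_conjugate x (\<phi> x)"
proof -
  obtain p :: "rat poly" where p: "irreducible p" "poly (map_poly of_rat p) x = 0"
    using algebraic_irreducible_poly[OF assms(1)] by blast
  let ?p = "map_poly of_rat p :: complex poly"
  have "?p \<in> polys" using Rats_subset by (auto simp: polys_def coeff_map_poly)
  moreover have "hom_poly ?p = ?p" by (rule poly_eqI) (simp add: coeff_map_poly fix_Rats)
  ultimately have "poly ?p (\<phi> x) = 0" using hom_poly_eval[of ?p x] assms p by simp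
  thus ?thesis using p by (auto simp: galois_conjugate_def)
qed

lemma (in rational_embedding) totally_real_hom:
  "x \<in> totally_real \<Longrightarrow> x \<in> D \<Longrightarrow> \<phi> x \<in> \<real>"
  using galois_conjugate_hom by (auto simp: totally_real_def)

text \<open>Converse of \<open>totally_real_hom\<close>. Any \<open>y\<close> at which the same
  rational polynomials vanish as at \<open>x\<close> is the image of \<open>x\<close> under an
  embedding of \<open>\<rat>[x]\<close>, hence real. This applies to \<open>x\<close> itself and to
  each Galois conjugate, while a transcendental \<open>x\<close> would admit a non-real
  \<open>y\<close>. Testing only countable \<open>D\<close> makes \<open>extend\<close> available
  when the criterion is used.\<close>

lemma totally_realI:
  assumes "\<And>D \<phi>. rational_embedding D \<phi> \<Longrightarrow> countable D \<Longrightarrow> x \<in> D \<Longrightarrow> \<phi> x \<in> \<real>"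
  shows "x \<in> totally_real"
proof -
  have adj: "y \<in> \<real>" if y: "\<And>q. q \<in> Rats.polys \<Longrightarrow> poly q x = 0 \<longleftrightarrow> poly q y = 0" for y
  proof -
    have "poly q x = 0 \<longleftrightarrow> poly (map_poly id q) y = 0" if "q \<in> Rats.polys" for q
      using y[OF that] by (simp add: map_poly_id)
    then obtain D' \<psi> where "rational_embedding D' \<psi>" "x \<in> D'" "\<psi> x = y" "countable D'"
      using Rats.adjoin[of x y] countable_rat by metis
    thus ?thesis using assms by blast
  qed
  have "x \<in> \<real>" using adj by blast
  moreover have "algebraic x"
  proof (rule ccontr)
    assume "\<not> algebraic x"
    hence *: "q = 0" if "q \<in> Rats.polys" "poly q x = 0" for q
      using that by (auto simp: algebraic_altdef Rats.polys_def)
    obtain y where "\<And>q. q \<in> Rats.polys \<Longrightarrow> poly q x = 0 \<longleftrightarrow> poly (map_poly id q) y = 0" "y \<notin> \<real>"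
      using Rats.same_zeros_exists[of x] countable_rat * by metis
    thus False using adj[of y] by (simp add: map_poly_id)
  qed
  moreover have "z \<in> \<real>" if "galois_conjugate x z" for z
  proof (rule adj)
    fix q assume "q \<in> Rats.polys"
    then obtain r where r: "q = map_poly of_rat r"
      using Rats_poly_of_rat_poly[of q] by (auto simp: Rats.polys_def)
    from that obtain p :: "rat poly" where "irreducible p" "poly (map_poly of_rat p) x = 0"
      "poly (map_poly of_rat p) z = 0" by (auto simp: galois_conjugate_def)
    thus "poly q x = 0 \<longleftrightarrow> poly q z = 0"
      unfolding r using irreducible_same_zeros by blast
  qed
  ultimately show ?thesis by (simp add: totally_real_def)
qed

section \<open>Rational numbers, sums and products among the totally real numbers\<close>

lemma totally_real_Rats: "\<rat> \<subseteq> totally_real"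
proof
  fix x :: complex assume x: "x \<in> \<rat>"
  show "x \<in> totally_real"
  proof (rule totally_realI)
    fix D \<phi> assume "rational_embedding D \<phi>"
    moreover from x obtain a b where "x = of_int a / of_int b" by (rule Rats_cases')
    ultimately show "\<phi> x \<in> \<real>" using x by (simp add: rational_embedding.fix_Rats)
  qed
qed

text \<open>An embedding defined at \<open>x + y\<close> or \<open>x * y\<close> need not be defined
  at \<open>x\<close> and \<open>y\<close>. After extending it to both, its value is the sum or
  product of two real numbers.\<close>

lemma totally_real_add_mult:
  assumes "x \<in> totally_real" "y \<in> totally_real"
  shows "x + y \<in> totally_real" "x * y \<in> totally_real"
proof -
  have "\<psi> (x + y) \<in> \<real> \<and> \<psi> (x * y) \<in> \<real>"
    if "rational_embedding D \<psi>" "{x, y} \<subseteq> D" for D \<psi>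
  proof -
    interpret rational_embedding D \<psi> by fact
    show ?thesis using that assms totally_real_hom by (simp add: hom_add hom_mult)
  qed
  note hom_real = this
  have "\<phi> (x + y) \<in> \<real>" if emb: "rational_embedding D \<phi>" "countable D" "x + y \<in> D" for D \<phi>
  proof -
    interpret rational_embedding D \<phi> by fact
    have "finite {x, y}" by simp
    then obtain D' \<psi> where *: "rational_embedding D' \<psi>" "D \<subseteq> D'" "{x, y} \<subseteq> D'"
      and eq: "\<forall>u\<in>D. \<psi> u = \<phi> u" and "countable D'"
      by (rule extend[OF emb(2)])
    show ?thesis using hom_real[OF *(1,3)] bspec[OF eq emb(3)] by simp
  qed
  thus "x + y \<in> totally_real" by (rule totally_realI)
  have "\<phi> (x * y) \<in> \<real>" if emb: "rational_embedding D \<phi>" "countable D" "x * y \<in> D" for D \<phi>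
  proof -
    interpret rational_embedding D \<phi> by fact
    have "finite {x, y}" by simp
    then obtain D' \<psi> where *: "rational_embedding D' \<psi>" "D \<subseteq> D'" "{x, y} \<subseteq> D'"
      and eq: "\<forall>u\<in>D. \<psi> u = \<phi> u" and "countable D'"
      by (rule extend[OF emb(2)])
    show ?thesis using hom_real[OF *(1,3)] bspec[OF eq emb(3)] by simp
  qed
  thus "x * y \<in> totally_real" by (rule totally_realI)
qed

section \<open>Critical points\<close>

lemma affine_functional_real: "affine_functional a b (x :: real ^ 'd::finite) = a \<bullet> x + b"
  by (simp add: affine_functional_def inner_vec_def)

lemma affine_functional_complexify:
  "affine_functional a b (complexify x) = complex_of_real (a \<bullet> x + b)"
  by (simp add: affine_functional_def inner_vec_def complexify_def)

lemma Im_affine_functional: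
  fixes z :: "complex ^ 'd::finite"
  shows "Im (affine_functional a b z) = a \<bullet> (\<chi> i. Im (z $ i))"
  by (simp add: affine_functional_def inner_vec_def)

lemma inj_complexify: "inj complexify"
  by (rule injI) (simp add: complexify_def vec_eq_iff)

lemma critical_points_iff:
  "z \<in> critical_points A a b \<epsilon> \<longleftrightarrow>
     (\<forall>H\<in>A. affine_functional (a H) (b H) z \<noteq> 0) \<and>
     (\<forall>i. (\<Sum>H\<in>A. of_real (a H $ i) * of_real (\<epsilon> H) / affine_functional (a H) (b H) z) = 0)"
  by (simp add: critical_points_def complex_complement_def complex_partial_affine_functional)

text \<open>The derivative of the master function in a real direction \<open>v\<close> combines the
  partial derivatives with coefficients \<open>v $ i\<close>.\<close>

lemma critical_points_directional:
  assumes "z \<in> critical_points A a b \<epsilon>"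
  shows "(\<Sum>H\<in>A. of_real (\<epsilon> H * (a H \<bullet> v)) / affine_functional (a H) (b H) z) = 0"
proof -
  have "(\<Sum>H\<in>A. of_real (\<epsilon> H * (a H \<bullet> v)) / affine_functional (a H) (b H) z) =
      (\<Sum>H\<in>A. \<Sum>i\<in>UNIV. of_real (v $ i) *
         (of_real (a H $ i) * of_real (\<epsilon> H) / affine_functional (a H) (b H) z))"
    by (intro sum.cong refl)
      (simp add: inner_vec_def sum_distrib_left sum_divide_distrib mult_ac)
  also have "\<dots> = (\<Sum>i\<in>UNIV. of_real (v $ i) *
         (\<Sum>H\<in>A. of_real (a H $ i) * of_real (\<epsilon> H) / affine_functional (a H) (b H) z))"
    by (subst sum.swap) (simp add: sum_distrib_left)
  also have "\<dots> = 0" using assms by (simp add: critical_points_iff)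
  finally show ?thesis .
qed

text \<open>Clears denominators, so that the critical equations become polynomial and an embedding
  of a ring can be applied to them.\<close>

lemma sum_divide_eq_0_iff:
  fixes c f :: "'a \<Rightarrow> 'b::field"
  assumes "finite A" "\<And>x. x \<in> A \<Longrightarrow> f x \<noteq> 0"
  shows "(\<Sum>x\<in>A. c x / f x) = 0 \<longleftrightarrow> (\<Sum>x\<in>A. c x * prod f (A - {x})) = 0"
proof -
  have "prod f A * (\<Sum>x\<in>A. c x / f x) = (\<Sum>x\<in>A. c x * prod f (A - {x}))"
    unfolding sum_distrib_left
    by (intro sum.cong refl) (use assms in \<open>simp add: prod.remove[of A _ f]\<close>)
  moreover have "prod f A \<noteq> 0" using assms by simp
  ultimately show ?thesis by (metis mult_eq_0_iff)
qed

section \<open>Images of critical points under embeddings\<close>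

lemma of_real_in_Rats: "x \<in> \<rat> \<Longrightarrow> (of_real x :: complex) \<in> \<rat>"
  by (elim Rats_cases') simp

context rational_embedding
begin

lemma affine_functional_hom:
  assumes "\<forall>i. a $ i \<in> \<rat>" "b \<in> \<rat>" "\<forall>i. z $ i \<in> D"
  shows "affine_functional a b z \<in> D"
    and "affine_functional a b (coordinatewise \<phi> z) = \<phi> (affine_functional a b z)"
proof -
  have q: "of_real (a $ i) \<in> (\<rat> :: complex set)" "of_real b \<in> (\<rat> :: complex set)" for i
    using assms of_real_in_Rats by auto
  hence D: "of_real (a $ i) \<in> D" "of_real b \<in> D" for i
    using Rats_subset by blast+
  show "affine_functional a b z \<in> D"
    unfolding affine_functional_def using D assms(3) by (intro add_closed sum_closed mult_closed) auto
  have "\<phi> (affine_functional a b z) = (\<Sum>i\<in>UNIV. \<phi> (of_real (a $ i)) * \<phi> (z $ i)) + \<phi> (of_real b)"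
    unfolding affine_functional_def using D assms(3)
    by (subst hom_add) (auto intro!: sum_closed mult_closed simp: hom_sum hom_mult mult_closed)
  thus "affine_functional a b (coordinatewise \<phi> z) = \<phi> (affine_functional a b z)"
    using q by (simp add: affine_functional_def coordinatewise_def fix_Rats)
qed

text \<open>The quotients \<open>c H / f H\<close> may lie outside \<open>D\<close>, so denominators
  are cleared before \<open>\<phi>\<close> is applied and restored afterwards. Injectivity keeps the
  values \<open>\<phi> (f H)\<close> nonzero.\<close>

lemma critical_points_hom:
  assumes "arrangement A a b" "defined_over_rationals A a b" "\<forall>H\<in>A. \<epsilon> H \<in> \<rat>"
    and z: "z \<in> critical_points A a b \<epsilon>" "\<forall>i. z $ i \<in> D"
  shows "coordinatewise \<phi> z \<in> critical_points A a b \<epsilon>"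
proof -
  define f where "f H = affine_functional (a H) (b H) z" for H
  have fin: "finite A" using assms(1) by (simp add: arrangement_def)
  have f: "f H \<in> D" "affine_functional (a H) (b H) (coordinatewise \<phi> z) = \<phi> (f H)" "f H \<noteq> 0" if "H \<in> A" for H
    using affine_functional_hom[of "a H" "b H" z] that assms z
    by (auto simp: defined_over_rationals_def f_def critical_points_iff)
  have nz: "\<phi> (f H) \<noteq> 0" if "H \<in> A" for H using f[OF that] by (simp add: hom_eq_0_iff)
  have "(\<Sum>H\<in>A. of_real (a H $ i) * of_real (\<epsilon> H) / \<phi> (f H)) = 0" for i
  proof -
    define c :: "(real ^ 'a) set \<Rightarrow> complex" where "c H = of_real (a H $ i) * of_real (\<epsilon> H)" for H
    have c: "c H \<in> \<rat>" if "H \<in> A" for H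
      using that assms unfolding c_def by (intro Rats_mult of_real_in_Rats) (auto simp: defined_over_rationals_def)
    hence cD: "c H \<in> D" if "H \<in> A" for H using that Rats_subset by auto
    have "(\<Sum>H\<in>A. c H / f H) = 0" using z by (simp add: critical_points_iff c_def f_def)
    hence "(\<Sum>H\<in>A. c H * prod f (A - {H})) = 0"
      using fin f by (subst (asm) sum_divide_eq_0_iff) auto
    hence "\<phi> (\<Sum>H\<in>A. c H * prod f (A - {H})) = 0" by simp
    also have "\<phi> (\<Sum>H\<in>A. c H * prod f (A - {H})) = (\<Sum>H\<in>A. \<phi> (c H * prod f (A - {H})))"
      using cD f by (intro hom_sum mult_closed prod_closed) auto
    also have "\<dots> = (\<Sum>H\<in>A. c H * (\<Prod>H\<in>A - {H}. \<phi> (f H)))"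
    proof (intro sum.cong refl)
      fix H assume "H \<in> A"
      have "\<phi> (c H * prod f (A - {H})) = \<phi> (c H) * \<phi> (prod f (A - {H}))"
        using cD[OF \<open>H \<in> A\<close>] f by (intro hom_mult prod_closed) auto
      also have "\<phi> (prod f (A - {H})) = (\<Prod>H\<in>A - {H}. \<phi> (f H))"
        using f by (intro hom_prod) auto
      finally show "\<phi> (c H * prod f (A - {H})) = c H * (\<Prod>H\<in>A - {H}. \<phi> (f H))"
        using c[OF \<open>H \<in> A\<close>] by (simp add: fix_Rats)
    qed
    finally have "(\<Sum>H\<in>A. c H / \<phi> (f H)) = 0"
      using fin nz by (subst sum_divide_eq_0_iff) auto
    thus ?thesis by (simp add: c_def)
  qed
  thus ?thesis using nz by (simp add: critical_points_iff f(2) cong: sum.cong)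
qed

end

section \<open>Critical points are real, with totally real coordinates\<close>

lemma essential_inner_eq_0:
  assumes "essential A a" "\<And>H. H \<in> A \<Longrightarrow> a H \<bullet> v = 0"
  shows "v = 0"
proof -
  have "orthogonal v v"
    by (rule orthogonal_to_span[of v "a ` A"])
      (use assms in \<open>auto simp: essential_def orthogonal_def inner_commute\<close>)
  thus ?thesis by (simp add: orthogonal_def)
qed

text \<open>
  Pairing the critical equations at \<open>z\<close> with the imaginary part of \<open>z\<close> gives
  $\sum_H \varepsilon_H (\mathrm{Im}\, f_H(z))^2 / |f_H(z)|^2 = 0$.
\<close>

lemma critical_points_real:
  assumes "arrangement A a b" "essential A a" "\<forall>H\<in>A. \<epsilon> H > 0"
    and z: "z \<in> critical_points A a b \<epsilon>"
  shows "z $ i \<in> \<real>"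
proof -
  define f where "f H = affine_functional (a H) (b H) z" for H
  define y where "y = (\<chi> i. Im (z $ i))"
  have fin: "finite A" using assms(1) by (simp add: arrangement_def)
  have Imf: "a H \<bullet> y = Im (f H)" for H by (simp add: f_def y_def Im_affine_functional)
  have nz: "f H \<noteq> 0" if "H \<in> A" for H using z that by (simp add: critical_points_iff f_def)
  have "(\<Sum>H\<in>A. of_real (\<epsilon> H * Im (f H)) / f H) = 0"
    using critical_points_directional[OF z, of y] by (simp add: Imf f_def)
  hence "(\<Sum>H\<in>A. Im (of_real (\<epsilon> H * Im (f H)) / f H)) = 0" by (metis Im_sum zero_complex.sel(2))
  moreover have "Im (of_real (\<epsilon> H * Im (f H)) / f H) = - (\<epsilon> H * (Im (f H))\<^sup>2 / (cmod (f H))\<^sup>2)" for H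
    by (simp add: Im_divide cmod_power2) (simp add: power2_eq_square)
  ultimately have "(\<Sum>H\<in>A. \<epsilon> H * (Im (f H))\<^sup>2 / (cmod (f H))\<^sup>2) = 0" by (simp add: sum_negf)
  hence "\<forall>H\<in>A. \<epsilon> H * (Im (f H))\<^sup>2 / (cmod (f H))\<^sup>2 = 0"
    using assms(3) fin by (subst (asm) sum_nonneg_eq_0_iff) (auto simp: less_imp_le)
  \<comment> \<open>All weights are positive, so each \<open>Im (f H)\<close> vanishes. Then
    \<open>y\<close> is orthogonal to every normal vector, and these span.\<close>
  hence "a H \<bullet> y = 0" if "H \<in> A" for H
    using that assms(3) nz[OF that] Imf by force
  hence "y = 0" using essential_inner_eq_0[OF assms(2)] by blast
  thus ?thesis by (simp add: y_def vec_eq_iff complex_is_Real_iff)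
qed

text \<open>An embedding given at one coordinate is extended to all of them. It then moves
  \<open>z\<close> to a critical point, whose coordinates are real.\<close>

lemma critical_points_totally_real:
  assumes "arrangement A a b" "essential A a" "defined_over_rationals A a b"
    and "\<forall>H\<in>A. \<epsilon> H > 0 \<and> \<epsilon> H \<in> \<rat>"
    and z: "z \<in> critical_points A a b \<epsilon>"
  shows "z $ i \<in> totally_real"
proof (rule totally_realI)
  fix D \<phi> assume emb: "rational_embedding D \<phi>" "countable D" "z $ i \<in> D"
  interpret rational_embedding D \<phi> by fact
  have "finite (range (($) z))" by simp
  then obtain D' \<psi> where D': "rational_embedding D' \<psi>" "D \<subseteq> D'" "range (($) z) \<subseteq> D'"
    and eq: "\<forall>u\<in>D. \<psi> u = \<phi> u" and "countable D'"
    by (rule extend[OF emb(2)])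
  interpret D': rational_embedding D' \<psi> by fact
  have "coordinatewise \<psi> z \<in> critical_points A a b \<epsilon>"
    using D'(3) assms by (intro D'.critical_points_hom) auto
  hence "coordinatewise \<psi> z $ i \<in> \<real>"
    using assms by (intro critical_points_real[of A a b \<epsilon>]) auto
  thus "\<phi> (z $ i) \<in> \<real>" using eq emb(3) by (simp add: coordinatewise_def)
qed

text \<open>All directions \<open>v\<close> are tested, not only the coordinate ones, because the
  arguments on a chamber use the direction \<open>y - x\<close> between two of its points.\<close>

definition real_critical_points ::
    "(real ^ 'd::finite) set set \<Rightarrow> ((real ^ 'd) set \<Rightarrow> real ^ 'd) \<Rightarrow> ((real ^ 'd) set \<Rightarrow> real) \<Rightarrow>
     ((real ^ 'd) set \<Rightarrow> real) \<Rightarrow> (real ^ 'd) set" where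
  "real_critical_points A a b \<epsilon> =
     {x. (\<forall>H\<in>A. a H \<bullet> x + b H \<noteq> 0) \<and> (\<forall>v. (\<Sum>H\<in>A. \<epsilon> H * (a H \<bullet> v) / (a H \<bullet> x + b H)) = 0)}"

lemma complexify_critical_iff:
  "complexify x \<in> critical_points A a b \<epsilon> \<longleftrightarrow> x \<in> real_critical_points A a b \<epsilon>"
proof
  assume crit: "complexify x \<in> critical_points A a b \<epsilon>"
  have "complex_of_real (\<Sum>H\<in>A. \<epsilon> H * (a H \<bullet> v) / (a H \<bullet> x + b H)) = 0" for v
    using critical_points_directional[OF crit, of v] by (simp add: affine_functional_complexify)
  thus "x \<in> real_critical_points A a b \<epsilon>"
    using crit by (auto simp: real_critical_points_def critical_points_iff affine_functional_complexify
        simp del: of_real_add of_real_sum)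
next
  assume crit: "x \<in> real_critical_points A a b \<epsilon>"
  have "(\<Sum>H\<in>A. of_real (a H $ i) * of_real (\<epsilon> H) / affine_functional (a H) (b H) (complexify x)) = 0" for i
  proof -
    have "(\<Sum>H\<in>A. \<epsilon> H * (a H \<bullet> axis i 1) / (a H \<bullet> x + b H)) = 0"
      using crit by (auto simp: real_critical_points_def)
    hence "complex_of_real (\<Sum>H\<in>A. a H $ i * \<epsilon> H / (a H \<bullet> x + b H)) = 0"
      by (simp add: inner_axis mult.commute)
    thus ?thesis by (simp add: affine_functional_complexify)
  qed
  thus "complexify x \<in> critical_points A a b \<epsilon>"
    using crit by (auto simp: critical_points_iff real_critical_points_def affine_functional_complexify
        simp del: of_real_add)
qed

lemma critical_points_eq_complexify:
  assumes "arrangement A a b" "essential A a" "\<forall>H\<in>A. \<epsilon> H > 0"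
  shows "critical_points A a b \<epsilon> = complexify ` real_critical_points A a b \<epsilon>"
proof (intro equalityI subsetI)
  fix z assume z: "z \<in> critical_points A a b \<epsilon>"
  have "z = complexify (\<chi> i. Re (z $ i))"
    using critical_points_real[OF assms z] by (simp add: complexify_def vec_eq_iff of_real_Re)
  thus "z \<in> complexify ` real_critical_points A a b \<epsilon>"
    using z complexify_critical_iff by (metis imageI)
qed (auto simp: complexify_critical_iff)


section \<open>Bounded chambers\<close>

lemma arrangement_complement:
  assumes "arrangement A a b"
  shows "UNIV - \<Union>A = {x. \<forall>H\<in>A. a H \<bullet> x + b H \<noteq> 0}"
  using assms by (auto simp: arrangement_def affine_functional_real)

lemma open_arrangement_complement:
  assumes "arrangement A a b"
  shows "open (UNIV - \<Union>A)"
proof -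
  have "closed H" if "H \<in> A" for H
  proof -
    have "H = {x. a H \<bullet> x = - b H}"
      using assms that by (auto simp: arrangement_def affine_functional_real add_eq_0_iff2)
    thus ?thesis by (metis closed_hyperplane)
  qed
  moreover have "finite A" using assms by (simp add: arrangement_def)
  ultimately show ?thesis by (auto intro!: open_Diff)
qed

text \<open>The image of the connected set \<open>C\<close> under the functional contains every
  interval between two of its values and misses 0.\<close>

lemma chamber_same_sign:
  assumes "arrangement A a b" "C \<in> chambers A" "x \<in> C" "y \<in> C" "H \<in> A"
  shows "(a H \<bullet> y + b H) / (a H \<bullet> x + b H) > 0"
proof -
  let ?f = "\<lambda>x. a H \<bullet> x + b H"
  have "connected C" "C \<subseteq> UNIV - \<Union>A"
    using assms(2) unfolding chambers_def by (rule in_components_connected, rule in_components_subset)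
  hence nz: "0 \<notin> ?f ` C" using arrangement_complement[OF assms(1)] assms(5) by auto
  have "connected (?f ` C)"
    using \<open>connected C\<close> by (intro connected_continuous_image continuous_intros)
  from connected_contains_Icc[OF this, of "?f x" "?f y"] connected_contains_Icc[OF this, of "?f y" "?f x"]
  have "{?f x..?f y} \<subseteq> ?f ` C" "{?f y..?f x} \<subseteq> ?f ` C"
    using assms(3,4) by auto
  hence "0 \<notin> {?f x..?f y}" "0 \<notin> {?f y..?f x}" using nz by blast+
  thus ?thesis by (auto simp: zero_less_divide_iff)
qed

text \<open>The description in \<open>chamber_of\<close> is unique because components are disjoint
  and \<open>complexify\<close> is injective.\<close>

lemma chamber_of_complexify:
  assumes "C \<in> chambers A" "x \<in> C"
  shows "chamber_of A (complexify x) = C"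
  unfolding chamber_of_def
proof (rule the_equality)
  show "C \<in> chambers A \<and> complexify x \<in> complexify ` C" using assms by blast
  fix C' assume "C' \<in> chambers A \<and> complexify x \<in> complexify ` C'"
  hence "C' \<in> chambers A" "x \<in> C'" using inj_complexify by (auto dest: injD)
  thus "C' = C" using assms components_eq[of C' _ C] unfolding chambers_def by blast
qed

lemma chamber_exists:
  assumes "x \<notin> \<Union>A"
  obtains C where "C \<in> chambers A" "x \<in> C"
  using assms Union_components[of "UNIV - \<Union>A"] unfolding chambers_def by blast

text \<open>Strict concavity in equational form: subtracting the critical equations at
  \<open>x\<close> and \<open>y\<close> in direction \<open>y - x\<close> leaves a sum of squares
  over the products \<open>f x H * f y H\<close>, which are positive on a common chamber.\<close>

lemma critical_point_unique:
  assumes "arrangement A a b" "essential A a" "\<forall>H\<in>A. \<epsilon> H > 0"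
    and "C \<in> chambers A" "x \<in> C" "y \<in> C"
    and "x \<in> real_critical_points A a b \<epsilon>" "y \<in> real_critical_points A a b \<epsilon>"
  shows "x = y"
proof -
  define f where "f u H = a H \<bullet> u + b H" for u H
  have fin: "finite A" using assms(1) by (simp add: arrangement_def)
  have nz: "f x H \<noteq> 0" "f y H \<noteq> 0" if "H \<in> A" for H
    using assms(7,8) that by (auto simp: real_critical_points_def f_def)
  have pos: "f y H / f x H > 0" if "H \<in> A" for H
    using chamber_same_sign[OF assms(1,4,5,6) that] by (simp add: f_def)
  have "(\<Sum>H\<in>A. \<epsilon> H * (a H \<bullet> (y - x)) / f x H) - (\<Sum>H\<in>A. \<epsilon> H * (a H \<bullet> (y - x)) / f y H) = 0"
    using assms(7,8) by (simp add: real_critical_points_def f_def)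
  also have "(\<Sum>H\<in>A. \<epsilon> H * (a H \<bullet> (y - x)) / f x H) - (\<Sum>H\<in>A. \<epsilon> H * (a H \<bullet> (y - x)) / f y H) =
      (\<Sum>H\<in>A. \<epsilon> H * (a H \<bullet> (y - x))\<^sup>2 / (f x H * f y H))"
    unfolding sum_subtractf[symmetric]
  proof (intro sum.cong refl)
    fix H assume "H \<in> A"
    have diff: "a H \<bullet> (y - x) = f y H - f x H" by (simp add: f_def inner_diff_right)
    show "\<epsilon> H * (a H \<bullet> (y - x)) / f x H - \<epsilon> H * (a H \<bullet> (y - x)) / f y H =
      \<epsilon> H * (a H \<bullet> (y - x))\<^sup>2 / (f x H * f y H)"
      unfolding diff using nz[OF \<open>H \<in> A\<close>] by (simp add: field_simps power2_eq_square)
  qed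
  finally have "(\<Sum>H\<in>A. \<epsilon> H * (a H \<bullet> (y - x))\<^sup>2 / (f x H * f y H)) = 0" .
  moreover have "f x H * f y H > 0" if "H \<in> A" for H
    using pos[OF that] by (simp add: zero_less_divide_iff zero_less_mult_iff) argo
  ultimately have "\<forall>H\<in>A. \<epsilon> H * (a H \<bullet> (y - x))\<^sup>2 / (f x H * f y H) = 0"
    using assms(3) fin by (subst (asm) sum_nonneg_eq_0_iff) (auto simp: less_imp_le)
  hence "a H \<bullet> (y - x) = 0" if "H \<in> A" for H
    using that assms(3) nz[OF that] by force
  thus ?thesis using essential_inner_eq_0[OF assms(2), of "y - x"] by simp
qed

text \<open>Boundedness of \<open>v \<bullet> x\<close> on \<open>C\<close> is inherited by linear
  combinations of the \<open>v\<close>, hence holds for the standard basis, and the norm is at most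
  the sum of the absolute coordinates.\<close>

lemma bounded_if_functionals_bounded:
  fixes C :: "'a::euclidean_space set"
  assumes "span S = UNIV" "\<And>v. v \<in> S \<Longrightarrow> bounded ((\<lambda>x. v \<bullet> x) ` C)"
  shows "bounded C"
proof -
  have "\<exists>M. \<forall>x\<in>C. \<bar>v \<bullet> x\<bar> \<le> M" for v
  proof -
    have "v \<in> span S" using assms by simp
    hence "bounded ((\<lambda>x. v \<bullet> x) ` C)"
    proof (induction rule: span_induct_alt)
      case base
      have "(\<lambda>x. 0 \<bullet> x) ` C \<subseteq> {0}" by auto
      thus ?case using finite_imp_bounded[of "{0}"] bounded_subset by blast
    next
      case (step c u v)
      have "bounded ((\<lambda>x. c * (u \<bullet> x)) ` C)"
        using bounded_scaling[OF assms(2)[OF step(1)], of c] by (simp add: image_image)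
      from bounded_plus_comp[OF this step(2)] show ?case
        by (simp add: inner_add_left)
    qed
    thus ?thesis by (simp add: bounded_iff)
  qed
  then obtain M where M: "\<And>v x. x \<in> C \<Longrightarrow> \<bar>v \<bullet> x\<bar> \<le> M v" by metis
  have "norm x \<le> (\<Sum>v\<in>Basis. M v)" if "x \<in> C" for x
  proof -
    have "norm x \<le> (\<Sum>v\<in>Basis. \<bar>x \<bullet> v\<bar>)" by (rule norm_le_l1)
    also have "\<dots> \<le> (\<Sum>v\<in>Basis. M v)"
      by (rule sum_mono) (use M[OF that] in \<open>simp add: inner_commute\<close>)
    finally show ?thesis .
  qed
  thus ?thesis unfolding bounded_iff by blast
qed

lemma chamber_bounded_if_critical:
  assumes "arrangement A a b" "essential A a" "\<forall>H\<in>A. \<epsilon> H > 0"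
    and "C \<in> chambers A" "x \<in> C" "x \<in> real_critical_points A a b \<epsilon>"
  shows "bounded C"
proof -
  define f where "f u H = a H \<bullet> u + b H" for u H
  have fin: "finite A" using assms(1) by (simp add: arrangement_def)
  have nz: "f x H \<noteq> 0" if "H \<in> A" for H
    using assms(6) that by (auto simp: real_critical_points_def f_def)
  have "bounded ((\<lambda>y. a H \<bullet> y) ` C)" if H: "H \<in> A" for H
  proof -
    have "\<bar>a H \<bullet> y\<bar> \<le> (\<Sum>H\<in>A. \<epsilon> H) / \<epsilon> H * \<bar>f x H\<bar> + \<bar>b H\<bar>" if "y \<in> C" for y
    proof -
      have pos: "f y K / f x K > 0" if "K \<in> A" for K
        using chamber_same_sign[OF assms(1,4,5) \<open>y \<in> C\<close> that] by (simp add: f_def)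
      \<comment> \<open>Since \<open>a K \<bullet> (y - x) = f y K - f x K\<close>, the critical
        equation at \<open>x\<close> fixes this weighted sum. Its terms are positive on the chamber,
        so each is at most the total.\<close>
      have "(\<Sum>K\<in>A. \<epsilon> K * (f y K / f x K)) - (\<Sum>K\<in>A. \<epsilon> K) = (\<Sum>K\<in>A. \<epsilon> K * (a K \<bullet> (y - x)) / f x K)"
        unfolding sum_subtractf[symmetric]
        by (intro sum.cong refl) (use nz in \<open>simp add: field_simps f_def inner_diff_right\<close>)
      also have "\<dots> = 0" using assms(6) by (simp add: real_critical_points_def f_def)
      finally have "(\<Sum>K\<in>A. \<epsilon> K * (f y K / f x K)) = (\<Sum>K\<in>A. \<epsilon> K)" by simp
      moreover have "\<epsilon> H * (f y H / f x H) \<le> (\<Sum>K\<in>A. \<epsilon> K * (f y K / f x K))"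
        using H fin assms(3) pos by (intro member_le_sum mult_nonneg_nonneg) (auto intro: less_imp_le)
      ultimately have "f y H / f x H \<le> (\<Sum>K\<in>A. \<epsilon> K) / \<epsilon> H"
        using H assms(3) by (simp add: pos_le_divide_eq mult.commute)
      hence "\<bar>f y H\<bar> / \<bar>f x H\<bar> \<le> (\<Sum>K\<in>A. \<epsilon> K) / \<epsilon> H"
        using pos[OF H] by (simp flip: abs_divide)
      hence "\<bar>f y H\<bar> \<le> (\<Sum>K\<in>A. \<epsilon> K) / \<epsilon> H * \<bar>f x H\<bar>"
        using nz[OF H] by (simp add: pos_divide_le_eq)
      moreover have "\<bar>a H \<bullet> y\<bar> \<le> \<bar>f y H\<bar> + \<bar>b H\<bar>" by (simp add: f_def)
      ultimately show ?thesis by linarith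
    qed
    thus ?thesis unfolding bounded_iff by auto
  qed
  thus ?thesis using assms(2) unfolding essential_def
    by (intro bounded_if_functionals_bounded[of "a ` A"]) auto
qed

text \<open>\<open>F\<close> attains a maximum on the compact closure of \<open>C\<close>. It is
  positive on \<open>C\<close> and 0 on the hyperplanes, so the maximum lies in the open set
  \<open>C\<close>, where the derivative of its logarithm must vanish.\<close>

lemma critical_point_exists:
  assumes "arrangement A a b" "\<forall>H\<in>A. \<epsilon> H > 0"
    and C: "C \<in> chambers A" "bounded C"
  obtains x where "x \<in> C" "x \<in> real_critical_points A a b \<epsilon>"
proof -
  define f where "f u H = a H \<bullet> u + b H" for u H
  \<comment> \<open>The exponential of the master function with absolute values. Unlike a sum of
    logarithms it is continuous up to the hyperplanes, where
    \<open>0 powr \<epsilon> H = 0\<close>.\<close>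
  define F where "F u = (\<Prod>H\<in>A. \<bar>f u H\<bar> powr \<epsilon> H)" for u
  have fin: "finite A" using assms(1) by (simp add: arrangement_def)
  have comp: "C \<in> components (UNIV - \<Union>A)" using C by (simp add: chambers_def)
  note compl = arrangement_complement[OF assms(1)]
  have "open C" by (rule open_components[OF open_arrangement_complement[OF assms(1)] comp])
  have CU: "C \<subseteq> UNIV - \<Union>A" using comp by (rule in_components_subset)
  hence nz: "f u H \<noteq> 0" if "u \<in> C" "H \<in> A" for u H using that compl by (auto simp: f_def)
  have "continuous_on (closure C) F" unfolding F_def f_def
    using assms(2) by (intro continuous_on_prod continuous_on_powr' continuous_intros) auto
  moreover have "compact (closure C)" using C(2) by simp
  moreover have "closure C \<noteq> {}" using in_components_nonempty[OF comp] by simp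
  ultimately obtain m where m: "m \<in> closure C" "\<And>y. y \<in> closure C \<Longrightarrow> F y \<le> F m"
    using continuous_attains_sup[of "closure C" F] by blast
  have Fpos: "F u > 0" if "u \<in> C" for u
    unfolding F_def using nz[OF that] by (intro prod_pos) simp
  have "F m > 0"
  proof -
    obtain u where "u \<in> C" using in_components_nonempty[OF comp] by blast
    thus ?thesis using Fpos[of u] m(2)[of u] closure_subset[of C] by force
  qed
  hence "F m \<noteq> 0" by simp
  hence "f m H \<noteq> 0" if "H \<in> A" for H using that fin by (auto simp: F_def)
  hence mU: "m \<in> UNIV - \<Union>A" unfolding compl by (simp add: f_def)
  \<comment> \<open>Adding a point of its closure keeps \<open>C\<close> connected, so a component
    contains each such point that lies in the complement.\<close>
  have "insert m C \<subseteq> C"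
  proof (rule components_maximal[OF comp])
    show "connected (insert m C)"
      by (rule connected_intermediate_closure[OF in_components_connected[OF comp]])
        (use m closure_subset in auto)
    show "insert m C \<subseteq> UNIV - \<Union>A" using CU mU by blast
    show "C \<inter> insert m C \<noteq> {}" using in_components_nonempty[OF comp] by blast
  qed
  hence mC: "m \<in> C" by blast
  \<comment> \<open>This is \<open>F y \<le> F m\<close> after taking logarithms. The quotients are
    positive on the chamber, so the absolute values disappear.\<close>
  have ineq: "(\<Sum>H\<in>A. \<epsilon> H * ln (f y H / f m H)) \<le> 0" if "y \<in> C" for y
  proof -
    have "(\<Sum>H\<in>A. \<epsilon> H * ln (f y H / f m H)) = (\<Sum>H\<in>A. ln (\<bar>f y H\<bar> powr \<epsilon> H) - ln (\<bar>f m H\<bar> powr \<epsilon> H))"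
    proof (intro sum.cong refl)
      fix H assume "H \<in> A"
      have "f y H / f m H = \<bar>f y H\<bar> / \<bar>f m H\<bar>"
        using chamber_same_sign[OF assms(1) C(1) mC that \<open>H \<in> A\<close>] by (simp add: f_def flip: abs_divide)
      thus "\<epsilon> H * ln (f y H / f m H) = ln (\<bar>f y H\<bar> powr \<epsilon> H) - ln (\<bar>f m H\<bar> powr \<epsilon> H)"
        using nz[OF that \<open>H \<in> A\<close>] nz[OF mC \<open>H \<in> A\<close>] by (simp add: ln_div ln_powr algebra_simps)
    qed
    also have "\<dots> = ln (F y) - ln (F m)"
      unfolding F_def sum_subtractf using fin nz[OF that] nz[OF mC] by (simp add: ln_prod)
    also have "\<dots> \<le> 0" using Fpos[OF that] m(2)[of y] that closure_subset[of C] by auto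
    finally show ?thesis .
  qed
  have "(\<Sum>H\<in>A. \<epsilon> H * (a H \<bullet> v) / f m H) = 0" for v
  proof -
    \<comment> \<open>The logarithm of \<open>F / F m\<close> along the line through
      \<open>m\<close> in direction \<open>v\<close>. It is at most 0 near \<open>t = 0\<close> and
      equals 0 there, so its derivative at 0 vanishes.\<close>
    define L where "L t = (\<Sum>H\<in>A. \<epsilon> H * ln (f (m + t *\<^sub>R v) H / f m H))" for t
    have "((\<lambda>t. ln (f (m + t *\<^sub>R v) H / f m H)) has_real_derivative (a H \<bullet> v) / f m H) (at 0)" if "H \<in> A" for H
      unfolding f_def inner_add_right inner_scaleR_right
      using nz[OF mC that] by (auto intro!: derivative_eq_intros simp: f_def)
    hence "(L has_real_derivative (\<Sum>H\<in>A. \<epsilon> H * ((a H \<bullet> v) / f m H))) (at 0)"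
      unfolding L_def by (intro DERIV_sum DERIV_cmult)
    moreover have "L 0 = 0" using nz[OF mC] by (simp add: L_def)
    moreover have "\<exists>d>0. \<forall>t. \<bar>0 - t\<bar> < d \<longrightarrow> m + t *\<^sub>R v \<in> C"
    proof -
      have "open ((\<lambda>t. m + t *\<^sub>R v) -` C)"
        using \<open>open C\<close> by (intro open_vimage continuous_intros)
      then obtain d where "d > 0" "ball 0 d \<subseteq> (\<lambda>t. m + t *\<^sub>R v) -` C"
        using mC openE[of "(\<lambda>t. m + t *\<^sub>R v) -` C" 0] by auto
      thus ?thesis by (intro exI[of _ d]) (auto simp: subset_iff dist_real_def)
    qed
    then obtain d where "d > 0" "\<forall>t. \<bar>0 - t\<bar> < d \<longrightarrow> L t \<le> 0"
      using ineq unfolding L_def by blast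
    ultimately have "(\<Sum>H\<in>A. \<epsilon> H * ((a H \<bullet> v) / f m H)) = 0"
      using DERIV_local_max[of L _ 0 d] by simp
    thus ?thesis by simp
  qed
  hence "m \<in> real_critical_points A a b \<epsilon>"
    using nz[OF mC] by (simp add: real_critical_points_def f_def)
  thus ?thesis using mC that by blast
qed

text \<open>Varchenko's theorem. A critical point forces its chamber to be bounded, two of them
  cannot share a chamber, and maximisation provides one in each bounded chamber.\<close>

lemma bij_betw_chamber_of:
  assumes "arrangement A a b" "essential A a" "\<forall>H\<in>A. \<epsilon> H > 0"
  shows "bij_betw (chamber_of A) (critical_points A a b \<epsilon>) (bounded_chambers A)"
    and "\<forall>z\<in>critical_points A a b \<epsilon>. z \<in> complexify ` chamber_of A z"
proof -
  let ?R = "real_critical_points A a b \<epsilon>"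
  note crit = critical_points_eq_complexify[OF assms]
  have ex: "\<exists>C\<in>bounded_chambers A. x \<in> C \<and> chamber_of A (complexify x) = C" if "x \<in> ?R" for x
  proof -
    have "x \<in> UNIV - \<Union>A"
      using that by (simp add: real_critical_points_def arrangement_complement[OF assms(1)])
    then obtain C where "C \<in> chambers A" "x \<in> C" using chamber_exists by blast
    moreover from this have "bounded C" using chamber_bounded_if_critical[OF assms] that by blast
    ultimately show ?thesis using chamber_of_complexify[of C A x] by (auto simp: bounded_chambers_def)
  qed
  show "\<forall>z\<in>critical_points A a b \<epsilon>. z \<in> complexify ` chamber_of A z"
    unfolding crit using ex by blast
  show "bij_betw (chamber_of A) (critical_points A a b \<epsilon>) (bounded_chambers A)"
    unfolding bij_betw_def
  proof
    show "inj_on (chamber_of A) (critical_points A a b \<epsilon>)"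
    proof (rule inj_onI)
      fix z w assume "z \<in> critical_points A a b \<epsilon>" "w \<in> critical_points A a b \<epsilon>"
        and eq: "chamber_of A z = chamber_of A w"
      then obtain x y where xy: "z = complexify x" "w = complexify y" "x \<in> ?R" "y \<in> ?R"
        unfolding crit by blast
      then obtain C where "C \<in> chambers A" "x \<in> C" "y \<in> C"
        using ex[of x] ex[of y] eq by (auto simp: bounded_chambers_def)
      thus "z = w" using critical_point_unique[OF assms] xy by blast
    qed
    show "chamber_of A ` critical_points A a b \<epsilon> = bounded_chambers A"
    proof (intro equalityI subsetI)
      fix C assume "C \<in> bounded_chambers A"
      hence C: "C \<in> chambers A" "bounded C" by (auto simp: bounded_chambers_def)
      then obtain x where "x \<in> C" "x \<in> ?R" using critical_point_exists[OF assms(1,3)] by blast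
      thus "C \<in> chamber_of A ` critical_points A a b \<epsilon>"
        unfolding crit using chamber_of_complexify[OF C(1)] by force
    qed (use ex in \<open>auto simp: crit\<close>)
  qed
qed


section \<open>The Galois action\<close>

text \<open>\<open>group_action\<close> asks for a homomorphism into \<open>BijGroup E\<close>,
  whose elements are extensional, hence the restriction to \<open>E\<close>. Bijectivity comes from
  the action of the inverse element.\<close>

lemma group_actionI:
  assumes "group G"
    and closed: "\<And>g x. g \<in> carrier G \<Longrightarrow> x \<in> E \<Longrightarrow> act g x \<in> E"
    and one: "\<And>x. x \<in> E \<Longrightarrow> act \<one>\<^bsub>G\<^esub> x = x"
    and mult: "\<And>g h x. g \<in> carrier G \<Longrightarrow> h \<in> carrier G \<Longrightarrow> x \<in> E \<Longrightarrow> act (g \<otimes>\<^bsub>G\<^esub> h) x = act g (act h x)"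
  shows "group_action G E (\<lambda>g. \<lambda>x\<in>E. act g x)"
proof -
  interpret group G by fact
  have Bij: "(\<lambda>x\<in>E. act g x) \<in> Bij E" if g: "g \<in> carrier G" for g
  proof -
    have "bij_betw (act g) E E"
      by (rule bij_betw_byWitness[where f' = "act (inv\<^bsub>G\<^esub> g)"])
        (use g closed one in \<open>auto simp flip: mult\<close>)
    thus ?thesis by (simp add: Bij_def)
  qed
  show ?thesis
    unfolding group_action_def group_hom_def group_hom_axioms_def
  proof (intro conjI homI)
    fix g h assume gh: "g \<in> carrier G" "h \<in> carrier G"
    show "(\<lambda>x\<in>E. act (g \<otimes>\<^bsub>G\<^esub> h) x) = (\<lambda>x\<in>E. act g x) \<otimes>\<^bsub>BijGroup E\<^esub> (\<lambda>x\<in>E. act h x)"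
      using gh Bij[OF gh(1)] Bij[OF gh(2)] closed mult
      by (auto simp: BijGroup_def compose_def fun_eq_iff)
  qed (use Bij group_BijGroup in \<open>auto simp: BijGroup_def assms(1)\<close>)
qed

text \<open>The action on \<open>E\<close> conjugated by \<open>f\<close>. In a composite the inner
  \<open>f\<close> and \<open>inv_into E f\<close> cancel, since the action stays in
  \<open>E\<close>.\<close>

lemma group_action_transport:
  assumes "group G"
    and closed: "\<And>g x. g \<in> carrier G \<Longrightarrow> x \<in> E \<Longrightarrow> act g x \<in> E"
    and one: "\<And>x. x \<in> E \<Longrightarrow> act \<one>\<^bsub>G\<^esub> x = x"
    and mult: "\<And>g h x. g \<in> carrier G \<Longrightarrow> h \<in> carrier G \<Longrightarrow> x \<in> E \<Longrightarrow> act (g \<otimes>\<^bsub>G\<^esub> h) x = act g (act h x)"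
    and f: "bij_betw f E F"
  shows "group_action G F (\<lambda>g. \<lambda>y\<in>F. f (act g (inv_into E f y)))"
proof (rule group_actionI[OF assms(1)])
  have inv: "inv_into E f y \<in> E" "f (inv_into E f y) = y" if "y \<in> F" for y
    using that f by (auto simp: bij_betw_def inv_into_into f_inv_into_f)
  fix g h y assume "g \<in> carrier G" "y \<in> F"
  show "f (act g (inv_into E f y)) \<in> F"
    using \<open>g \<in> carrier G\<close> \<open>y \<in> F\<close> inv closed f by (auto simp: bij_betw_def)
next
  fix y assume "y \<in> F"
  thus "f (act \<one>\<^bsub>G\<^esub> (inv_into E f y)) = y"
    using f by (auto simp: bij_betw_def inv_into_into f_inv_into_f one)
next
  fix g h y assume gh: "g \<in> carrier G" "h \<in> carrier G" and y: "y \<in> F"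
  have "inv_into E f y \<in> E" using y f by (auto simp: bij_betw_def inv_into_into)
  thus "f (act (g \<otimes>\<^bsub>G\<^esub> h) (inv_into E f y)) = f (act g (inv_into E f (f (act h (inv_into E f y)))))"
    using gh closed bij_betw_inv_into_left[OF f] by (simp add: mult)
qed

text \<open>A subgroup of \<open>BijGroup L\<close>. Closure of \<open>L\<close> under sums and
  products is what lets additivity and multiplicativity pass to composites and inverses.\<close>

lemma group_galois_group:
  assumes L: "\<And>x y. x \<in> L \<Longrightarrow> y \<in> L \<Longrightarrow> x + y \<in> L" "\<And>x y. x \<in> L \<Longrightarrow> y \<in> L \<Longrightarrow> x * y \<in> L"
    and "K \<subseteq> L"
  shows "group (galois_group L K)"
proof -
  interpret B: group "BijGroup L" by (rule group_BijGroup)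
  let ?G = "carrier (galois_group L K)"
  have G: "\<sigma> \<in> ?G \<longleftrightarrow> \<sigma> \<in> Bij L \<and> (\<forall>x\<in>L. \<forall>y\<in>L. \<sigma> (x + y) = \<sigma> x + \<sigma> y \<and> \<sigma> (x * y) = \<sigma> x * \<sigma> y) \<and>
      (\<forall>x\<in>K. \<sigma> x = x)" for \<sigma>
    by (simp add: galois_group_def)
  have "subgroup ?G (BijGroup L)"
  proof (rule B.subgroupI)
    show "?G \<subseteq> carrier (BijGroup L)" by (auto simp: G BijGroup_def)
    have "(\<lambda>x\<in>L. x) \<in> ?G" using L \<open>K \<subseteq> L\<close> by (auto simp: G id_Bij)
    thus "?G \<noteq> {}" by blast
  next
    fix \<sigma> \<tau> assume *: "\<sigma> \<in> ?G" "\<tau> \<in> ?G"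
    have "\<tau> x \<in> L" if "x \<in> L" for x using * that by (auto simp: G dest!: Bij_imp_funcset)
    moreover have "compose L \<sigma> \<tau> \<in> Bij L" using * by (simp add: G compose_Bij)
    ultimately show "\<sigma> \<otimes>\<^bsub>BijGroup L\<^esub> \<tau> \<in> ?G"
      using * L \<open>K \<subseteq> L\<close> by (auto simp: G BijGroup_def compose_eq subset_iff)
  next
    fix \<sigma> assume \<sigma>: "\<sigma> \<in> ?G"
    hence bij: "bij_betw \<sigma> L L" by (simp add: G Bij_def)
    let ?i = "inv_into L \<sigma>"
    have i: "?i x \<in> L" "\<sigma> (?i x) = x" "?i (\<sigma> x) = x" if "x \<in> L" for x
      using bij that by (auto simp: bij_betw_def inv_into_into f_inv_into_f)
    have "?i (x + y) = ?i x + ?i y" "?i (x * y) = ?i x * ?i y" if "x \<in> L" "y \<in> L" for x y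
    proof -
      have "\<sigma> (?i x + ?i y) = x + y" "\<sigma> (?i x * ?i y) = x * y"
        using \<sigma> i that by (auto simp: G)
      thus "?i (x + y) = ?i x + ?i y" "?i (x * y) = ?i x * ?i y"
        using i(3)[of "?i x + ?i y"] i(3)[of "?i x * ?i y"] i(1) that L by auto
    qed
    moreover have "?i x = x" if "x \<in> K" for x
      using \<sigma> i(3)[of x] that \<open>K \<subseteq> L\<close> by (auto simp: G)
    ultimately have "(\<lambda>x\<in>L. ?i x) \<in> ?G"
      using \<sigma> L \<open>K \<subseteq> L\<close> by (auto simp: G restrict_inv_into_Bij)
    thus "inv\<^bsub>BijGroup L\<^esub> \<sigma> \<in> ?G" using \<sigma> by (simp add: inv_BijGroup G)
  qed
  from B.subgroup_imp_group[OF this] show ?thesis by (simp add: galois_group_def)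
qed

text \<open>Makes \<open>critical_points_hom\<close> applicable to Galois automorphisms, with
  \<open>totally_real\<close> as the domain.\<close>

lemma galois_group_rational_embedding:
  assumes "\<sigma> \<in> carrier (galois_group totally_real \<rat>)"
  shows "rational_embedding totally_real \<sigma>"
  using assms totally_real_Rats totally_real_add_mult
  by unfold_locales (auto simp: galois_group_def Bij_def bij_betw_def)

theorem theoremA1:
  fixes A :: "(real ^ 'd::finite) set set"
    and a :: "(real ^ 'd) set \<Rightarrow> real ^ 'd"
    and b :: "(real ^ 'd) set \<Rightarrow> real"
    and \<epsilon> :: "(real ^ 'd) set \<Rightarrow> real"
  assumes "arrangement A a b"
    and "essential A a"
    and "defined_over_rationals A a b"
    and "\<forall>H\<in>A. \<epsilon> H > 0 \<and> \<epsilon> H \<in> \<rat>"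
  defines "G \<equiv> galois_group totally_real \<rat>"
    and "Crit \<equiv> critical_points A a b \<epsilon>"
  shows "(\<forall>x\<in>Crit. \<forall>i. x $ i \<in> totally_real) \<and>
         group_action G Crit (\<lambda>\<sigma>. \<lambda>x\<in>Crit. coordinatewise \<sigma> x) \<and>
         bij_betw (chamber_of A) Crit (bounded_chambers A) \<and>
         (\<forall>x\<in>Crit. x \<in> complexify ` chamber_of A x) \<and>
         group_action G (bounded_chambers A)
           (\<lambda>\<sigma>. \<lambda>C\<in>bounded_chambers A.
              chamber_of A (coordinatewise \<sigma> (inv_into Crit (chamber_of A) C)))"
proof -
  have pos: "\<forall>H\<in>A. \<epsilon> H > 0" and rat: "\<forall>H\<in>A. \<epsilon> H \<in> \<rat>" using assms(4) by auto
  note bij = bij_betw_chamber_of[OF assms(1,2) pos, folded Crit_def]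
  have tr: "x $ i \<in> totally_real" if "x \<in> Crit" for x i
    using critical_points_totally_real[OF assms(1-4)] that by (simp add: Crit_def)
  have group: "group G"
    unfolding G_def using totally_real_add_mult totally_real_Rats by (intro group_galois_group)
  have closed: "coordinatewise \<sigma> x \<in> Crit" if "\<sigma> \<in> carrier G" "x \<in> Crit" for \<sigma> x
    using rational_embedding.critical_points_hom[OF galois_group_rational_embedding assms(1,3) rat, of \<sigma> x]
      that tr by (auto simp: G_def Crit_def)
  \<comment> \<open>The unit of \<open>G\<close> and the composites in \<open>G\<close> are
    restricted to \<open>totally_real\<close>, so they behave as the identity and as compositions
    only because the coordinates of \<open>x\<close> lie there.\<close>
  have one: "coordinatewise \<one>\<^bsub>G\<^esub> x = x" if "x \<in> Crit" for x
    using tr[OF that] by (simp add: G_def galois_group_def BijGroup_def coordinatewise_def vec_eq_iff)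
  have mult: "coordinatewise (\<sigma> \<otimes>\<^bsub>G\<^esub> \<tau>) x = coordinatewise \<sigma> (coordinatewise \<tau> x)"
    if "\<sigma> \<in> carrier G" "\<tau> \<in> carrier G" "x \<in> Crit" for \<sigma> \<tau> x
    using tr[OF that(3)] that(1,2)
    by (simp add: G_def galois_group_def BijGroup_def coordinatewise_def vec_eq_iff compose_def)
  note act = group_actionI[where act = coordinatewise, OF group closed one mult]
  note act' = group_action_transport[where act = coordinatewise, OF group closed one mult bij(1)]
  show ?thesis
    using tr bij act act' by blast
qed

end
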